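(* Let $S$ be a semiring and $G$ a cancellative torsion-free commutative monoid. Then $S[G]$ is a content $S$-semialgebra if and only if $S$ is a subtractive semiring.
   Context: A semiring is a set $S$ with operations $+,\cdot$ such that $(S,+)$ is a commutative monoid with identity $0$, $(S,\cdot)$ is a commutative monoid with identity $1\neq 0$, multiplication distributes over addition, and $s\cdot 0=0$ for all $s\in S$. A commutative monoid $G$ (written additively) is cancellative if $a+b=a+c$ implies $b=c$, and torsion-free if $na=nb$ with $n\geq 1$ implies $a=b$. $S[G]$ is the monoid semiring (finite formal sums $\sum s_iX^{g_i}$ with $X^gX^h=X^{g+h}$). An ideal $I$ of $S$ is a nonempty subset closed under addition and under multiplication by elements of $S$; it is subtractive if $a+b\in I$ and $a\in I$ imply $b\in I$. The semiring $S$ is subtractive if each of its ideals is subtractive. For an $S$-semialgebra $B$ (a semiring $B$ with a semiring morphism $S\to B$) and $f\in B$, $c(f)$ is the intersection of all ideals $I$ of $S$ with $f\in IB$; for $B=S[G]$, $c(f)$ is the ideal of $S$ generated by the coefficients of $f$, and one has $f\in c(f)B$, $c(sf)=s\,c(f)$ for $s\in S$, and $c(1)=S$. That $S[G]$ is a content $S$-semialgebra means that the Dedekind–Mertens content formula holds: for all $f,g\in S[G]$ there exists an integer $m\geq 0$ such that $c(f)^{m+1}c(g)=c(f)^m c(fg)$ (with $c(f)^0=S$).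
   Formalization: The monoid G is additionally assumed to be nontrivial; for G = {0} the claim fails, since S[G] = S is then always a content S-semialgebra, while for example the semiring of natural numbers is not subtractive. *)

theory Defs
  imports Main "HOL-Library.Poly_Mapping"
begin

text \<open>
  A semiring in the sense used here (commutative, with \<open>0\<close> absorbing and \<open>1 \<noteq> 0\<close>) is a type
  of class \<^class>\<open>comm_semiring_1\<close>.
\<close>

definition semiring_ideal :: "'s::comm_semiring_1 set \<Rightarrow> bool" where
  "semiring_ideal I \<longleftrightarrow>
     I \<noteq> {} \<and> (\<forall>a\<in>I. \<forall>b\<in>I. a + b \<in> I) \<and> (\<forall>s. \<forall>a\<in>I. s * a \<in> I)"

definition subtractive_ideal :: "'s::comm_semiring_1 set \<Rightarrow> bool" where
  "subtractive_ideal I \<longleftrightarrow> semiring_ideal I \<and> (\<forall>a b. a + b \<in> I \<longrightarrow> a \<in> I \<longrightarrow> b \<in> I)"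

definition subtractive_semiring :: "'s::comm_semiring_1 itself \<Rightarrow> bool" where
  "subtractive_semiring _ \<longleftrightarrow> (\<forall>I::'s set. semiring_ideal I \<longrightarrow> subtractive_ideal I)"

definition ideal_gen :: "'s::comm_semiring_1 set \<Rightarrow> 's set" where
  "ideal_gen X = \<Inter>{I. semiring_ideal I \<and> X \<subseteq> I}"

definition ideal_mult :: "'s::comm_semiring_1 set \<Rightarrow> 's set \<Rightarrow> 's set" where
  "ideal_mult I J = ideal_gen {a * b | a b. a \<in> I \<and> b \<in> J}"

primrec ideal_power :: "'s::comm_semiring_1 set \<Rightarrow> nat \<Rightarrow> 's set" where
  "ideal_power I 0 = UNIV"
| "ideal_power I (Suc m) = ideal_mult I (ideal_power I m)"

definition semiring_morphism :: "('s::comm_semiring_1 \<Rightarrow> 'b::comm_semiring_1) \<Rightarrow> bool" where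
  "semiring_morphism \<phi> \<longleftrightarrow>
     \<phi> 0 = 0 \<and> \<phi> 1 = 1 \<and> (\<forall>a b. \<phi> (a + b) = \<phi> a + \<phi> b) \<and> (\<forall>a b. \<phi> (a * b) = \<phi> a * \<phi> b)"

text \<open>
  A semialgebra is given by its structure morphism \<open>\<phi>\<close> from \<open>S\<close> to \<open>B\<close>;
  \<open>ideal_ext \<phi> I\<close> is the ideal \<open>IB\<close> of \<open>B\<close>.
\<close>

definition ideal_ext ::
    "('s::comm_semiring_1 \<Rightarrow> 'b::comm_semiring_1) \<Rightarrow> 's set \<Rightarrow> 'b set" where
  "ideal_ext \<phi> I = ideal_gen (\<phi> ` I)"

definition content :: "('s::comm_semiring_1 \<Rightarrow> 'b::comm_semiring_1) \<Rightarrow> 'b \<Rightarrow> 's set" where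
  "content \<phi> f = \<Inter>{I. semiring_ideal I \<and> f \<in> ideal_ext \<phi> I}"

definition dedekind_mertens :: "('s::comm_semiring_1 \<Rightarrow> 'b::comm_semiring_1) \<Rightarrow> bool" where
  "dedekind_mertens \<phi> \<longleftrightarrow>
     (\<forall>f g. \<exists>m. ideal_mult (ideal_power (content \<phi> f) (m + 1)) (content \<phi> g)
               = ideal_mult (ideal_power (content \<phi> f) m) (content \<phi> (f * g)))"

definition content_semialgebra ::
    "('s::comm_semiring_1 \<Rightarrow> 'b::comm_semiring_1) \<Rightarrow> bool" where
  "content_semialgebra \<phi> \<longleftrightarrow>
     semiring_morphism \<phi> \<and>
     (\<forall>f. f \<in> ideal_ext \<phi> (content \<phi> f)) \<and>
     (\<forall>s f. content \<phi> (\<phi> s * f) = (*) s ` content \<phi> f) \<and>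
     content \<phi> 1 = UNIV \<and>
     dedekind_mertens \<phi>"

text \<open>
  The class \<open>cancel_comm_monoid_add\<close> is not used for cancellative monoids: it also provides a
  subtraction operation satisfying \<open>a - b - c = a - (b + c)\<close> for all arguments, which is additional
  structure. The multiple \<open>n a\<close> is written as a constant sum.
\<close>

definition cancellative_monoid :: "'g::comm_monoid_add itself \<Rightarrow> bool" where
  "cancellative_monoid _ \<longleftrightarrow> (\<forall>a b c :: 'g. a + b = a + c \<longrightarrow> b = c)"

definition torsion_free_monoid :: "'g::comm_monoid_add itself \<Rightarrow> bool" where
  "torsion_free_monoid _ \<longleftrightarrow>
     (\<forall>(a::'g) b (n::nat). n \<ge> 1 \<longrightarrow> (\<Sum>i<n. a) = (\<Sum>i<n. b) \<longrightarrow> a = b)"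

text \<open>
  The monoid semiring \<open>S[G]\<close> is the type \<open>'g \<Rightarrow>\<^sub>0 's\<close> of finitely supported functions with
  convolution product; \<open>s X\<^sup>g\<close> is \<open>Poly_Mapping.single g s\<close>.
\<close>

abbreviation monoid_semiring_embedding ::
    "'s::comm_semiring_1 \<Rightarrow> ('g::comm_monoid_add \<Rightarrow>\<^sub>0 's)" where
  "monoid_semiring_embedding \<equiv> Poly_Mapping.single 0"

text \<open>
  For \<open>S[G]\<close> the content is the ideal generated by the coefficients, and every clause of
  \<^const>\<open>content_semialgebra\<close> other than the Dedekind-Mertens formula holds automatically.
\<close>

lemma semiring_ideal_zero: "semiring_ideal I \<Longrightarrow> 0 \<in> I"
  unfolding semiring_ideal_def by (metis ex_in_conv mult_zero_left)

lemma semiring_ideal_sum: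
  "semiring_ideal I \<Longrightarrow> (\<And>x. h x \<in> I) \<Longrightarrow> sum h A \<in> I"
  by (induction A rule: infinite_finite_induct)
    (auto simp: semiring_ideal_zero, auto simp: semiring_ideal_def)

lemma semiring_ideal_Sum_any:
  "semiring_ideal I \<Longrightarrow> (\<And>x. h x \<in> I) \<Longrightarrow> Sum_any h \<in> I"
  by (simp add: Sum_any.expand_set semiring_ideal_sum)

lemma semiring_ideal_Inter:
  "(\<And>I. I \<in> F \<Longrightarrow> semiring_ideal I) \<Longrightarrow> semiring_ideal (\<Inter>F)"
proof -
  assume *: "\<And>I. I \<in> F \<Longrightarrow> semiring_ideal I"
  then have "0 \<in> \<Inter>F" by (auto intro: semiring_ideal_zero)
  then show ?thesis using * unfolding semiring_ideal_def by blast
qed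

lemma semiring_ideal_ideal_gen: "semiring_ideal (ideal_gen X)"
  unfolding ideal_gen_def by (rule semiring_ideal_Inter) auto

lemma ideal_gen_superset: "X \<subseteq> ideal_gen X"
  unfolding ideal_gen_def by blast

lemma ideal_gen_least: "semiring_ideal I \<Longrightarrow> X \<subseteq> I \<Longrightarrow> ideal_gen X \<subseteq> I"
  unfolding ideal_gen_def by blast

lemma in_ideal_ext_monoid_semiring:
  fixes f :: "'g::comm_monoid_add \<Rightarrow>\<^sub>0 's::comm_semiring_1"
  assumes I: "semiring_ideal I"
  shows "f \<in> ideal_ext monoid_semiring_embedding I \<longleftrightarrow> range (Poly_Mapping.lookup f) \<subseteq> I"
proof
  let ?J = "{f :: 'g \<Rightarrow>\<^sub>0 's. range (Poly_Mapping.lookup f) \<subseteq> I}"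
  have 0: "0 \<in> I" using I by (rule semiring_ideal_zero)
  have "semiring_ideal ?J"
    unfolding semiring_ideal_def
  proof (intro conjI ballI allI)
    have "0 \<in> ?J" using 0 by auto
    then show "?J \<noteq> {}" by blast
  next
    fix a b assume "a \<in> ?J" "b \<in> ?J"
    then show "a + b \<in> ?J" using I by (auto simp: lookup_add semiring_ideal_def)
  next
    fix s a assume a: "a \<in> ?J"
    have "Poly_Mapping.lookup (s * a) k \<in> I" for k
    proof -
      have "Poly_Mapping.lookup s l * (\<Sum>q. Poly_Mapping.lookup a q when k = l + q) \<in> I" for l
      proof -
        have "(\<Sum>q. Poly_Mapping.lookup a q when k = l + q) \<in> I"
          using I by (rule semiring_ideal_Sum_any) (use a 0 in \<open>auto simp: when_def\<close>)
        then show ?thesis using I by (simp add: semiring_ideal_def)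
      qed
      then show ?thesis unfolding lookup_mult using I by (intro semiring_ideal_Sum_any)
    qed
    then show "s * a \<in> ?J" by auto
  qed
  moreover have "monoid_semiring_embedding ` I \<subseteq> ?J"
    using 0 by (auto simp: lookup_single when_def)
  ultimately have "ideal_ext monoid_semiring_embedding I \<subseteq> ?J"
    unfolding ideal_ext_def by (rule ideal_gen_least)
  then show "f \<in> ideal_ext monoid_semiring_embedding I \<Longrightarrow> range (Poly_Mapping.lookup f) \<subseteq> I" by blast
next
  let ?K = "ideal_ext monoid_semiring_embedding I :: ('g \<Rightarrow>\<^sub>0 's) set"
  have K: "semiring_ideal ?K"
    unfolding ideal_ext_def by (rule semiring_ideal_ideal_gen)
  show "range (Poly_Mapping.lookup f) \<subseteq> I \<Longrightarrow> f \<in> ?K"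
  proof (induction f rule: update_induct)
    case const
    show ?case using K by (rule semiring_ideal_zero)
  next
    case (update f k s)
    have "s \<in> I"
      using update.prems by (metis UNIV_I image_subset_iff lookup_update)
    then have "monoid_semiring_embedding s \<in> ?K"
      unfolding ideal_ext_def using ideal_gen_superset by blast
    then have "Poly_Mapping.single k 1 * monoid_semiring_embedding s \<in> ?K"
      using K by (simp add: semiring_ideal_def)
    then have s: "Poly_Mapping.single k s \<in> ?K" by (simp add: mult_single)
    have "Poly_Mapping.lookup f l \<in> I" for l
      using update.prems update.hyps(1) semiring_ideal_zero[OF I]
      by (cases "l = k") (auto simp: lookup_update in_keys_iff image_subset_iff split: if_splits)
    then have "f \<in> ?K" using update.IH by blast
    with s have "Poly_Mapping.single k s + f \<in> ?K" using K by (simp add: semiring_ideal_def)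
    moreover have "Poly_Mapping.update k s f = Poly_Mapping.single k s + f"
      using update.hyps(1)
      by (intro poly_mapping_eqI)
        (auto simp: lookup_update lookup_add lookup_single when_def in_keys_iff)
    ultimately show ?case by simp
  qed
qed

lemma content_monoid_semiring:
  fixes f :: "'g::comm_monoid_add \<Rightarrow>\<^sub>0 's::comm_semiring_1"
  shows "content monoid_semiring_embedding f = ideal_gen (range (Poly_Mapping.lookup f))"
  unfolding content_def ideal_gen_def
  by (rule arg_cong[where f = Inter], rule Collect_cong) (metis in_ideal_ext_monoid_semiring)

lemma ideal_gen_scale: "ideal_gen ((*) s ` X) = (*) s ` ideal_gen X"
proof
  have "semiring_ideal ((*) s ` ideal_gen X)"
    using semiring_ideal_ideal_gen[of X] unfolding semiring_ideal_def
    by (auto simp: image_iff) (metis distrib_left, metis mult.left_commute)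
  then show "ideal_gen ((*) s ` X) \<subseteq> (*) s ` ideal_gen X"
    by (rule ideal_gen_least) (use ideal_gen_superset in blast)
next
  let ?I = "{x. s * x \<in> ideal_gen ((*) s ` X)}"
  have "0 \<in> ?I" by (simp add: semiring_ideal_zero semiring_ideal_ideal_gen)
  then have "?I \<noteq> {}" by blast
  then have "semiring_ideal ?I"
    using semiring_ideal_ideal_gen[of "(*) s ` X"] unfolding semiring_ideal_def
    by (simp add: distrib_left mult.left_commute[of s])
  then have "ideal_gen X \<subseteq> ?I"
    by (rule ideal_gen_least) (use ideal_gen_superset in blast)
  then show "(*) s ` ideal_gen X \<subseteq> ideal_gen ((*) s ` X)" by blast
qed

lemma content_semialgebra_monoid_semiring_iff:
  "content_semialgebra (monoid_semiring_embedding :: 's::comm_semiring_1 \<Rightarrow> ('g::comm_monoid_add \<Rightarrow>\<^sub>0 's))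
   \<longleftrightarrow> dedekind_mertens (monoid_semiring_embedding :: 's \<Rightarrow> ('g \<Rightarrow>\<^sub>0 's))"
proof -
  let ?\<phi> = "monoid_semiring_embedding :: 's \<Rightarrow> ('g \<Rightarrow>\<^sub>0 's)"
  have "semiring_morphism ?\<phi>"
    by (auto simp: semiring_morphism_def single_add mult_single)
  moreover have "f \<in> ideal_ext ?\<phi> (content ?\<phi> f)" for f
    by (simp add: in_ideal_ext_monoid_semiring content_monoid_semiring semiring_ideal_ideal_gen
        ideal_gen_superset)
  moreover have "content ?\<phi> (?\<phi> s * f) = (*) s ` content ?\<phi> f" for s f
  proof -
    have "Poly_Mapping.lookup (?\<phi> s * f) k = s * Poly_Mapping.lookup f k" for k
      by (simp add: mult_map_scale_conv_mult[symmetric] map.rep_eq when_def)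
    then have "range (Poly_Mapping.lookup (?\<phi> s * f)) = (*) s ` range (Poly_Mapping.lookup f)"
      by (simp add: image_image)
    then show ?thesis by (simp add: content_monoid_semiring ideal_gen_scale)
  qed
  moreover have "content ?\<phi> 1 = UNIV"
  proof -
    have "Poly_Mapping.lookup (1 :: 'g \<Rightarrow>\<^sub>0 's) 0 \<in> content ?\<phi> 1"
      unfolding content_monoid_semiring using ideal_gen_superset by blast
    then have "1 \<in> content ?\<phi> 1" by (simp add: lookup_one)
    moreover have "semiring_ideal (content ?\<phi> 1)"
      unfolding content_monoid_semiring by (rule semiring_ideal_ideal_gen)
    ultimately have "x * 1 \<in> content ?\<phi> 1" for x
      unfolding semiring_ideal_def by blast
    then show ?thesis by auto
  qed
  ultimately show ?thesis unfolding content_semialgebra_def by blast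
qed

end

theory Submission
  imports Defs
begin

text \<open>
  If \<open>S[G]\<close> is a content semialgebra, apply the content formula to \<open>f = 1 + X\<^sup>g\<close>, whose content is
  \<open>S\<close>, and \<open>h = a + b X\<^sup>g + a X\<^bsup>2g\<^esup>\<close>: as \<open>fh\<close> has coefficients \<open>a, a + b, a + b, a\<close>, this puts \<open>b\<close>
  into the ideal generated by \<open>a\<close> and \<open>a + b\<close>.

  Conversely, a finite nonempty subset of a cancellative torsion-free monoid has an extreme point,
  and an extreme point of \<open>supp f + supp g\<close> is a sum \<open>s + t\<close> in only one way. So the product of the
  coefficients \<open>a\<close> and \<open>b\<close> at \<open>s\<close> and \<open>t\<close> is a coefficient of \<open>fg\<close>. Write \<open>f = a X\<^sup>s + f'\<close> and
  \<open>g = b X\<^sup>t + g'\<close>. The inclusion \<open>c(f)\<^bsup>m+1\<^esup> c(g) \<subseteq> c(f)\<^sup>m c(fg)\<close> for \<open>g\<close> with at most \<open>m + 1\<close> terms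
  follows by induction from the inclusions for \<open>(f, g')\<close> with \<open>m - 1\<close> and \<open>(f', g)\<close> with \<open>m\<close>, where
  subtractivity of the right-hand ideal replaces the subtractions \<open>fg' = fg - b X\<^sup>t f\<close> and
  \<open>f'g = fg - a X\<^sup>s g\<close>.
\<close>

section \<open>Extreme points and unique sums\<close>

definition nmult :: "nat \<Rightarrow> 'g::comm_monoid_add \<Rightarrow> 'g" where
  "nmult n a = (\<Sum>i<n. a)"

lemma nmult_0 [simp]: "nmult 0 a = 0"
  and nmult_Suc [simp]: "nmult (Suc n) a = nmult n a + a"
  by (simp_all add: nmult_def)

lemma nmult_add: "nmult (m + n) a = nmult m a + nmult n a"
  by (induction n) (simp_all add: add.assoc)

lemma nmult_add_right: "nmult n (a + b) = nmult n a + nmult n b"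
  by (simp add: nmult_def sum.distrib)

lemma nmult_mult: "nmult (m * n) a = nmult m (nmult n a)"
  by (induction m) (simp_all add: nmult_add add.commute)

lemma nmult_sum: "nmult n (\<Sum>x\<in>A. h x) = (\<Sum>x\<in>A. nmult n (h x))"
  unfolding nmult_def by (rule sum.swap)

lemma nmult_sum_left: "nmult (\<Sum>x\<in>A. w x) a = (\<Sum>x\<in>A. nmult (w x) a)"
  by (induction A rule: infinite_finite_induct) (simp_all add: nmult_add)

lemma cancellative_monoid_cancel:
  fixes a b c :: "'g::comm_monoid_add"
  shows "cancellative_monoid TYPE('g) \<Longrightarrow> a + b = a + c \<longleftrightarrow> b = c"
  unfolding cancellative_monoid_def by blast

lemma torsion_free_monoid_nmult_cancel:
  fixes a b :: "'g::comm_monoid_add"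
  shows "torsion_free_monoid TYPE('g) \<Longrightarrow> n > 0 \<Longrightarrow> nmult n a = nmult n b \<Longrightarrow> a = b"
  unfolding torsion_free_monoid_def nmult_def by (metis Suc_leI One_nat_def)

text \<open>Convexity without division: weights \<open>w\<close> of positive total stand for a
  rational convex combination with its denominators cleared, and the equation says that the weighted
  mean is \<open>c\<close>. Only weight on \<open>c\<close> itself may achieve this.\<close>

definition extreme_point :: "'g::comm_monoid_add set \<Rightarrow> 'g \<Rightarrow> bool" where
  "extreme_point C c \<longleftrightarrow> c \<in> C \<and>
     (\<forall>w. (\<Sum>x\<in>C. nmult (w x) x) = nmult (\<Sum>x\<in>C. w x) c \<longrightarrow> (\<forall>x\<in>C. x \<noteq> c \<longrightarrow> w x = 0))"

text \<open>
  In the induction, either the new point is extreme, or it is a rational convex combination of the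
  old points, and then an old extreme point stays extreme.
\<close>

lemma extreme_point_exists:
  fixes C :: "'g::comm_monoid_add set"
  assumes canc: "cancellative_monoid TYPE('g)" and tf: "torsion_free_monoid TYPE('g)"
    and "finite C" "C \<noteq> {}"
  shows "\<exists>c. extreme_point C c"
  using \<open>finite C\<close> \<open>C \<noteq> {}\<close>
proof (induction C rule: finite_ne_induct)
  case (singleton z)
  show ?case by (auto simp: extreme_point_def)
next
  case (insert z C)
  then obtain c where c: "c \<in> C"
    and ext: "\<And>w x. (\<Sum>x\<in>C. nmult (w x) x) = nmult (\<Sum>x\<in>C. w x) c \<Longrightarrow> x \<in> C \<Longrightarrow> x \<noteq> c \<Longrightarrow> w x = 0"
    unfolding extreme_point_def by blast
  show ?case
  proof (cases "extreme_point (insert z C) z")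
    case False
    then obtain w y where w: "(\<Sum>x\<in>insert z C. nmult (w x) x) = nmult (\<Sum>x\<in>insert z C. w x) z"
      and y: "y \<in> C" "w y \<noteq> 0"
      unfolding extreme_point_def by auto
    define N where "N = (\<Sum>x\<in>C. w x)"
    have "N > 0" using y insert.hyps(1) unfolding N_def by (metis gr0I sum_eq_0_iff)
    have wz: "(\<Sum>x\<in>C. nmult (w x) x) = nmult N z"
      using w insert.hyps unfolding N_def
      by (simp add: nmult_add cancellative_monoid_cancel[OF canc])
    have "v x = 0" if v: "(\<Sum>x\<in>insert z C. nmult (v x) x) = nmult (\<Sum>x\<in>insert z C. v x) c"
      and x: "x \<in> insert z C" "x \<noteq> c" for v x
    proof -
      \<comment> \<open>Taking \<open>N\<close> copies of the relation for \<open>v\<close> and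
        replacing \<open>nmult N z\<close> through \<open>wz\<close> eliminates \<open>z\<close>.
        The extremality of \<open>c\<close> among the old points then applies to
        \<open>u\<close>.\<close>
      define u where "u = (\<lambda>x. N * v x + v z * w x)"
      have "(\<Sum>x\<in>C. nmult (u x) x) = nmult N (\<Sum>x\<in>C. nmult (v x) x) + nmult (v z) (nmult N z)"
        by (simp add: u_def nmult_add nmult_mult sum.distrib nmult_sum flip: wz)
      also have "\<dots> = nmult N (\<Sum>x\<in>insert z C. nmult (v x) x)"
        using insert.hyps
        by (simp add: nmult_add_right add.commute mult.commute flip: nmult_mult)
      also have "\<dots> = nmult (\<Sum>x\<in>C. u x) c"
      proof -
        have "(\<Sum>x\<in>C. u x) = N * (\<Sum>x\<in>insert z C. v x)"
          unfolding u_def sum.distrib sum_distrib_left[symmetric] N_def[symmetric]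
          using insert.hyps by (simp add: algebra_simps)
        then show ?thesis unfolding v by (simp add: nmult_mult)
      qed
      finally have u0: "u x = 0" if "x \<in> C" "x \<noteq> c" for x
        using ext that by blast
      show ?thesis
      proof (cases "x = z")
        case False
        then show ?thesis using u0[of x] x \<open>N > 0\<close> by (simp add: u_def)
      next
        case True
        show ?thesis
        proof (rule ccontr)
          \<comment> \<open>A positive weight at \<open>z\<close> forces \<open>w\<close> to vanish
            away from \<open>c\<close>, so \<open>wz\<close> reads \<open>N z = N c\<close>, and
            torsion-freeness gives \<open>z = c\<close>.\<close>
          assume "v x \<noteq> 0"
          then have "w x = 0" if "x \<in> C" "x \<noteq> c" for x
            using u0[OF that] True by (simp add: u_def)
          then have "(\<Sum>x\<in>C. nmult (w x) x) = (\<Sum>x\<in>C. nmult (w x) c)"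
            by (intro sum.cong) (auto, metis nmult_0)
          then have "nmult N z = nmult N c"
            by (simp add: wz N_def nmult_sum_left)
          then show False
            using torsion_free_monoid_nmult_cancel[OF tf \<open>N > 0\<close>] True x by blast
        qed
      qed
    qed
    then show ?thesis
      using c unfolding extreme_point_def by (intro exI[of _ c] conjI allI impI ballI insertI2)
  qed blast
qed

text \<open>
  If \<open>c = a + b = a' + b'\<close> then \<open>2c = (a + b') + (a' + b)\<close>, so extremality forces \<open>a + b' = c\<close>.
\<close>

lemma unique_sum_exists:
  fixes A B :: "'g::comm_monoid_add set"
  assumes canc: "cancellative_monoid TYPE('g)" and tf: "torsion_free_monoid TYPE('g)"
    and A: "finite A" "A \<noteq> {}" and B: "finite B" "B \<noteq> {}"
  obtains a b where "a \<in> A" "b \<in> B"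
    "\<And>a' b'. a' \<in> A \<Longrightarrow> b' \<in> B \<Longrightarrow> a' + b' = a + b \<Longrightarrow> a' = a \<and> b' = b"
proof -
  define C where "C = (\<lambda>(x, y). x + y) ` (A \<times> B)"
  have fin: "finite C" and "C \<noteq> {}" using A B by (auto simp: C_def)
  then obtain c where c: "c \<in> C"
    and ext: "\<And>w x. (\<Sum>x\<in>C. nmult (w x) x) = nmult (\<Sum>x\<in>C. w x) c \<Longrightarrow> x \<in> C \<Longrightarrow> x \<noteq> c \<Longrightarrow> w x = 0"
    using extreme_point_exists[OF canc tf] unfolding extreme_point_def by metis
  from c obtain a b where ab: "a \<in> A" "b \<in> B" "c = a + b" by (auto simp: C_def)
  have "a' = a \<and> b' = b" if ab': "a' \<in> A" "b' \<in> B" "a' + b' = a + b" for a' b'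
  proof -
    \<comment> \<open>The two indicators are added so that a coincidence
      \<open>a + b' = a' + b\<close> gets weight 2; the total weight is 2 in either case.\<close>
    define w where "w = (\<lambda>x. (if x = a + b' then 1 else 0) + (if x = a' + b then 1 else (0::nat)))"
    have mem: "a + b' \<in> C" "a' + b \<in> C" using ab ab' by (auto simp: C_def)
    have if_nmult: "nmult (if P then 1 else 0) x = (if P then x else 0)" for P and x :: 'g
      by simp
    have "(\<Sum>x\<in>C. nmult (w x) x) = (a + b') + (a' + b)"
      using mem fin unfolding w_def nmult_add if_nmult sum.distrib by simp
    also have "\<dots> = (a + b) + (a' + b')" by (simp add: ac_simps)
    also have "\<dots> = nmult (\<Sum>x\<in>C. w x) c"
      using mem fin by (simp add: w_def sum.distrib ab ab')
    finally have "a + b' \<noteq> c \<Longrightarrow> w (a + b') = 0" using ext mem by blast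
    then have "a + b' = a + b" by (auto simp: w_def ab split: if_splits)
    then show ?thesis
      using ab' cancellative_monoid_cancel[OF canc] by (metis add.commute)
  qed
  with ab show ?thesis using that by blast
qed

section \<open>Products of ideals and coefficients\<close>

lemma semiring_ideal_mult: "semiring_ideal I \<Longrightarrow> a \<in> I \<Longrightarrow> s * a \<in> I"
  unfolding semiring_ideal_def by blast

lemma semiring_ideal_colon:
  assumes "semiring_ideal K"
  shows "semiring_ideal {x. s * x \<in> K}"
proof -
  have "0 \<in> {x. s * x \<in> K}" using assms by (simp add: semiring_ideal_zero)
  then have "{x. s * x \<in> K} \<noteq> {}" by blast
  then show ?thesis
    using assms unfolding semiring_ideal_def by (simp add: distrib_left mult.left_commute[of s])
qed

text \<open>The colon ideal \<open>K : s\<close> contains the generators, hence the ideal they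
  generate. Later inclusions with an extra factor are checked on generators this way.\<close>

lemma ideal_gen_colon:
  assumes "semiring_ideal K" "\<And>x. x \<in> X \<Longrightarrow> s * x \<in> K" "x \<in> ideal_gen X"
  shows "s * x \<in> K"
  using ideal_gen_least[OF semiring_ideal_colon[OF assms(1), of s], of X] assms(2,3) by blast

lemma semiring_ideal_ideal_mult: "semiring_ideal (ideal_mult I J)"
  unfolding ideal_mult_def by (rule semiring_ideal_ideal_gen)

lemma ideal_multI: "a \<in> I \<Longrightarrow> b \<in> J \<Longrightarrow> a * b \<in> ideal_mult I J"
  unfolding ideal_mult_def by (rule subsetD[OF ideal_gen_superset]) blast

lemma ideal_mult_colon:
  assumes "semiring_ideal K" "\<And>a b. a \<in> I \<Longrightarrow> b \<in> J \<Longrightarrow> s * (a * b) \<in> K" "x \<in> ideal_mult I J"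
  shows "s * x \<in> K"
  using assms(3) unfolding ideal_mult_def
  by (rule ideal_gen_colon[OF assms(1), rotated]) (use assms(2) in blast)

lemma ideal_mult_least:
  assumes "semiring_ideal K" "\<And>a b. a \<in> I \<Longrightarrow> b \<in> J \<Longrightarrow> a * b \<in> K"
  shows "ideal_mult I J \<subseteq> K"
  unfolding ideal_mult_def using assms by (intro ideal_gen_least) auto

lemma ideal_mult_mono: "I \<subseteq> I' \<Longrightarrow> J \<subseteq> J' \<Longrightarrow> ideal_mult I J \<subseteq> ideal_mult I' J'"
  by (intro ideal_mult_least semiring_ideal_ideal_mult) (auto intro: ideal_multI)

lemma ideal_power_mono: "I \<subseteq> J \<Longrightarrow> ideal_power I n \<subseteq> ideal_power J n"
  by (induction n) (simp_all add: ideal_mult_mono)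

lemma semiring_ideal_UNIV: "semiring_ideal UNIV"
  by (simp add: semiring_ideal_def)

lemma semiring_ideal_ideal_power: "semiring_ideal (ideal_power I n)"
  by (cases n) (simp_all add: semiring_ideal_UNIV semiring_ideal_ideal_mult)

text \<open>This is \<open>((a) + I)\<^bsup>n+1\<^esup> \<subseteq> a ((a) + I)\<^sup>n + I\<^bsup>n+1\<^esup>\<close>, stated without sums of ideals.\<close>

lemma ideal_power_insert_subset:
  assumes "semiring_ideal K"
    and "\<And>u. u \<in> ideal_power (ideal_gen (insert a I)) n \<Longrightarrow> a * u \<in> K"
    and "ideal_power I (Suc n) \<subseteq> K"
  shows "ideal_power (ideal_gen (insert a I)) (Suc n) \<subseteq> K"
  using assms
proof (induction n arbitrary: K)
  case (0 K)
  have "x * s \<in> K" if "x \<in> ideal_gen (insert a I)" for x s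
  proof -
    have "s * y \<in> K" if "y \<in> insert a I" for y
      using that 0 ideal_multI[of y I s UNIV] by (auto simp: mult.commute)
    then show ?thesis
      using ideal_gen_colon[OF 0(1) _ that, of s] by (simp add: mult.commute)
  qed
  then show ?case
    unfolding ideal_power.simps by (intro ideal_mult_least 0(1))
next
  case (Suc n K)
  let ?U = "ideal_gen (insert a I)"
  have sub: "I \<subseteq> ?U" using ideal_gen_superset by blast
  have "y * u \<in> K" if y: "y \<in> insert a I" and u: "u \<in> ideal_power ?U (Suc n)" for y u
  proof (cases "y = a")
    case False
    then have "y \<in> I" using y by blast
    \<comment> \<open>The induction hypothesis is used for the colon ideal \<open>K : y\<close>,
      which is why \<open>K\<close> varies in the induction.\<close>
    have "ideal_power ?U (Suc n) \<subseteq> {u. y * u \<in> K}"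
    proof (rule Suc.IH)
      show "semiring_ideal {u. y * u \<in> K}" using Suc.prems(1) by (rule semiring_ideal_colon)
      show "a * u \<in> {u. y * u \<in> K}" if "u \<in> ideal_power ?U n" for u
        using Suc.prems(2)[of "y * u"] ideal_multI[of y ?U u "ideal_power ?U n"] that \<open>y \<in> I\<close> sub
        by (auto simp: mult.left_commute)
      show "ideal_power I (Suc n) \<subseteq> {u. y * u \<in> K}"
        using Suc.prems(3) ideal_multI[OF \<open>y \<in> I\<close>, of _ "ideal_power I (Suc n)"] by auto
    qed
    then show ?thesis using u by blast
  qed (use u Suc.prems(2) in blast)
  then have "u * x \<in> K" if "x \<in> ?U" "u \<in> ideal_power ?U (Suc n)" for x u
    using ideal_gen_colon[OF Suc.prems(1) _ that(1), of u] that(2) by (metis mult.commute)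
  then show ?case
    unfolding ideal_power.simps(2)[of ?U "Suc n"]
    by (intro ideal_mult_least Suc.prems(1)) (metis mult.commute)
qed

section \<open>Coefficient ideals, which are the contents in \<open>S[G]\<close> by
  \<open>content_monoid_semiring\<close>\<close>

abbreviation coeff_ideal :: "('g \<Rightarrow>\<^sub>0 's::comm_semiring_1) \<Rightarrow> 's set" where
  "coeff_ideal f \<equiv> ideal_gen (range (Poly_Mapping.lookup f))"

lemma lookup_in_coeff_ideal: "Poly_Mapping.lookup f k \<in> coeff_ideal f"
  by (rule subsetD[OF ideal_gen_superset]) blast

lemma coeff_ideal_zero: "coeff_ideal 0 \<subseteq> {0}"
  by (rule ideal_gen_least) (auto simp: semiring_ideal_def)

lemma lookup_times_in_ideal:
  fixes f g :: "'g::comm_monoid_add \<Rightarrow>\<^sub>0 's::comm_semiring_1"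
  assumes I: "semiring_ideal I"
    and "\<And>i j. Poly_Mapping.lookup f i * Poly_Mapping.lookup g j \<in> I"
  shows "Poly_Mapping.lookup (f * g) k \<in> I"
  unfolding lookup_mult
proof (rule semiring_ideal_Sum_any[OF I])
  fix l
  have "(\<Sum>q. Poly_Mapping.lookup g q when k = l + q) \<in> {x. Poly_Mapping.lookup f l * x \<in> I}"
    by (rule semiring_ideal_Sum_any[OF semiring_ideal_colon[OF I]])
      (use assms in \<open>auto simp: when_def semiring_ideal_zero\<close>)
  then show "Poly_Mapping.lookup f l * (\<Sum>q. Poly_Mapping.lookup g q when k = l + q) \<in> I" by simp
qed

lemma lookup_single_times_in_ideal:
  fixes g :: "'g::comm_monoid_add \<Rightarrow>\<^sub>0 's::comm_semiring_1"
  assumes "semiring_ideal I" "\<And>j. a * Poly_Mapping.lookup g j \<in> I"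
  shows "Poly_Mapping.lookup (Poly_Mapping.single s a * g) k \<in> I"
  using assms by (intro lookup_times_in_ideal) (auto simp: lookup_single when_def semiring_ideal_zero)

lemma single_plus_update_zero:
  "f = Poly_Mapping.single s (Poly_Mapping.lookup f s) + Poly_Mapping.update s 0 f"
  by (rule poly_mapping_eqI) (auto simp: lookup_add lookup_single lookup_update when_def)

lemma keys_update_zero: "Poly_Mapping.keys (Poly_Mapping.update s 0 f) = Poly_Mapping.keys f - {s}"
  by (auto simp: in_keys_iff lookup_update split: if_splits)

text \<open>Split off the terms at \<open>s\<close> and \<open>t\<close>: of the resulting products
  only that of the two split-off terms can reach the exponent \<open>s + t\<close>.\<close>

lemma lookup_times_unique_sum:
  fixes f g :: "'g::comm_monoid_add \<Rightarrow>\<^sub>0 's::comm_semiring_1"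
  assumes "\<And>s' t'. s' \<in> Poly_Mapping.keys f \<Longrightarrow> t' \<in> Poly_Mapping.keys g \<Longrightarrow> s' + t' = s + t \<Longrightarrow> s' = s \<and> t' = t"
    and "s \<in> Poly_Mapping.keys f"
  shows "Poly_Mapping.lookup (f * g) (s + t) = Poly_Mapping.lookup f s * Poly_Mapping.lookup g t"
proof -
  let ?X = "Poly_Mapping.single s (Poly_Mapping.lookup f s)"
  have "s + t \<notin> Poly_Mapping.keys (Poly_Mapping.update s 0 f * g)"
    using keys_mult[of "Poly_Mapping.update s 0 f" g] assms(1) unfolding keys_update_zero by fastforce
  moreover have "s + t \<notin> Poly_Mapping.keys (?X * Poly_Mapping.update t 0 g)"
    using keys_mult[of ?X "Poly_Mapping.update t 0 g"] assms unfolding keys_update_zero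
    by (fastforce split: if_splits)
  moreover have "f * g = ?X * (Poly_Mapping.single t (Poly_Mapping.lookup g t) + Poly_Mapping.update t 0 g)
      + Poly_Mapping.update s 0 f * g"
    by (metis single_plus_update_zero distrib_right)
  ultimately show ?thesis
    by (simp add: lookup_add distrib_left mult_single in_keys_iff)
qed

section \<open>The content formula\<close>

text \<open>The easy half of the content formula: coefficients of \<open>f * g\<close> are sums of
  products of coefficients of \<open>f\<close> and \<open>g\<close>.\<close>

lemma coeff_ideal_times_subset:
  fixes f g :: "'g::comm_monoid_add \<Rightarrow>\<^sub>0 's::comm_semiring_1"
  shows "ideal_mult (ideal_power (coeff_ideal f) m) (coeff_ideal (f * g))
    \<subseteq> ideal_mult (ideal_power (coeff_ideal f) (Suc m)) (coeff_ideal g)" (is "_ \<subseteq> ?K")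
proof (rule ideal_mult_least)
  show K: "semiring_ideal ?K" by (rule semiring_ideal_ideal_mult)
  fix u x assume u: "u \<in> ideal_power (coeff_ideal f) m" and x: "x \<in> coeff_ideal (f * g)"
  have "u * (Poly_Mapping.lookup f i * Poly_Mapping.lookup g j) \<in> ?K" for i j
    using ideal_multI[OF ideal_multI[OF lookup_in_coeff_ideal u] lookup_in_coeff_ideal, of f i g j]
    by (simp add: ac_simps)
  then have "u * Poly_Mapping.lookup (f * g) k \<in> ?K" for k
    using lookup_times_in_ideal[OF semiring_ideal_colon[OF K, of u], of f g k] by simp
  then show "u * x \<in> ?K" using ideal_gen_colon[OF K _ x] by blast
qed

lemma dedekind_mertens_inclusion:
  fixes f g :: "'g::comm_monoid_add \<Rightarrow>\<^sub>0 's::comm_semiring_1"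
  assumes canc: "cancellative_monoid TYPE('g)" and tf: "torsion_free_monoid TYPE('g)"
    and subtr: "subtractive_semiring TYPE('s)"
    and "card (Poly_Mapping.keys g) \<le> Suc m"
  shows "ideal_mult (ideal_power (coeff_ideal f) (Suc m)) (coeff_ideal g)
    \<subseteq> ideal_mult (ideal_power (coeff_ideal f) m) (coeff_ideal (f * g))"
  using assms(4)
\<comment> \<open>The measure drops in both uses: \<open>(f, g')\<close> lowers \<open>m\<close> by
  one, matched by the lost term of \<open>g\<close> in the bound, and \<open>(f', g)\<close> keeps
  \<open>m\<close> but loses a term of \<open>f\<close>.\<close>
proof (induction "m + card (Poly_Mapping.keys f)" arbitrary: m f g rule: less_induct)
  case (less m f g)
  let ?U = "coeff_ideal f" and ?V = "coeff_ideal g"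
  let ?K = "ideal_mult (ideal_power ?U m) (coeff_ideal (f * g))"
  have K: "semiring_ideal ?K" by (rule semiring_ideal_ideal_mult)
  \<comment> \<open>Subtractivity enters here, and every subtraction below goes through this
    fact.\<close>
  have K_cancel: "y \<in> ?K" if "x + y \<in> ?K" "x \<in> ?K" for x y
    using subtr K that unfolding subtractive_semiring_def subtractive_ideal_def by blast
  show ?case
  \<comment> \<open>An empty support has no extreme point. For \<open>f = 0\<close> the left side
    vanishes because its exponent \<open>Suc m\<close> is positive.\<close>
  proof (cases "f = 0 \<or> g = 0")
    case True
    have "u * v = 0" if u: "u \<in> ideal_power ?U (Suc m)" and v: "v \<in> ?V" for u v
    proof (cases "f = 0")
      case True
      then have "ideal_power ?U (Suc m) \<subseteq> {0}"
        unfolding ideal_power.simps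
        by (intro ideal_mult_least) (use coeff_ideal_zero in \<open>auto simp: semiring_ideal_def\<close>)
      then show ?thesis using u by auto
    next
      case False
      then show ?thesis using True v coeff_ideal_zero by fastforce
    qed
    then show ?thesis by (intro ideal_mult_least K) (simp add: semiring_ideal_zero[OF K])
  next
    case False
    then obtain s t where s: "s \<in> Poly_Mapping.keys f" and t: "t \<in> Poly_Mapping.keys g"
      and st: "\<And>s' t'. s' \<in> Poly_Mapping.keys f \<Longrightarrow> t' \<in> Poly_Mapping.keys g \<Longrightarrow>
        s' + t' = s + t \<Longrightarrow> s' = s \<and> t' = t"
      using unique_sum_exists[OF canc tf, of "Poly_Mapping.keys f" "Poly_Mapping.keys g"]
      by (metis finite_keys keys_eq_empty)
    define a b where "a = Poly_Mapping.lookup f s" and "b = Poly_Mapping.lookup g t"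
    define f' g' where "f' = Poly_Mapping.update s 0 f" and "g' = Poly_Mapping.update t 0 g"
    let ?U' = "coeff_ideal f'" and ?V' = "coeff_ideal g'"
    have f: "f = Poly_Mapping.single s a + f'" and g: "g = Poly_Mapping.single t b + g'"
      unfolding a_def b_def f'_def g'_def by (rule single_plus_update_zero)+
    have lookup_f: "Poly_Mapping.lookup f k \<in> insert a (range (Poly_Mapping.lookup f'))"
      and lookup_g: "Poly_Mapping.lookup g k \<in> insert b (range (Poly_Mapping.lookup g'))" for k
      by (auto simp: a_def b_def f'_def g'_def lookup_update image_iff)
    have f'_sub: "?U' \<subseteq> ?U"
      by (rule ideal_gen_least[OF semiring_ideal_ideal_gen])
        (auto simp: f'_def lookup_update lookup_in_coeff_ideal semiring_ideal_zero semiring_ideal_ideal_gen)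
    have a: "a \<in> ?U" unfolding a_def by (rule lookup_in_coeff_ideal)
    have "Poly_Mapping.lookup (f * g) (s + t) = a * b"
      unfolding a_def b_def by (rule lookup_times_unique_sum) (fact st s)+
    then have ab: "a * b \<in> coeff_ideal (f * g)" by (metis lookup_in_coeff_ideal)
    have K_ab: "u * (a * b) \<in> ?K" if "u \<in> ideal_power ?U m" for u
      using that ab by (rule ideal_multI)
    \<comment> \<open>For \<open>m = 0\<close> there is no inclusion with exponent
      \<open>m - 1\<close> to invoke, but then \<open>t\<close> is the only term of
      \<open>g\<close>.\<close>
    have g'_zero: "v = 0" if "m = 0" "v \<in> ?V'" for v
    proof -
      have "Poly_Mapping.keys g' = {}"
        using less.prems t that(1) unfolding g'_def keys_update_zero
        by (metis One_nat_def card_le_Suc0_iff_eq finite_keys Diff_eq_empty_iff singletonI subsetI)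
      then show ?thesis using coeff_ideal_zero that(2) by fastforce
    qed
    have card_g': "card (Poly_Mapping.keys g') \<le> Suc l" if "m = Suc l" for l
      using less.prems t that by (simp add: g'_def keys_update_zero)
    have IH_g': "ideal_mult (ideal_power ?U (Suc l)) ?V' \<subseteq> ideal_mult (ideal_power ?U l) (coeff_ideal (f * g'))"
      if "m = Suc l" for l
      using less.hyps[of l f g'] card_g' that by simp
    have "card (Poly_Mapping.keys f') < card (Poly_Mapping.keys f)"
      unfolding f'_def keys_update_zero using s by (intro card_Diff1_less finite_keys)
    then have IH_f': "ideal_mult (ideal_power ?U' (Suc m)) ?V \<subseteq> ideal_mult (ideal_power ?U' m) (coeff_ideal (f' * g))"
      using less.hyps[of m f' g] less.prems by simp
    have fg': "f * g = Poly_Mapping.single t b * f + f * g'"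
      by (subst g) (simp add: distrib_left mult.commute)
    have f'g: "f * g = Poly_Mapping.single s a * g + f' * g"
      by (subst f) (simp add: distrib_right)

    \<comment> \<open>This replaces \<open>f g' = f g - b X^t f\<close>; the price is that
      \<open>b * u\<close> must carry the coefficients of \<open>f\<close> into
      \<open>?K\<close>.\<close>
    have fg'_K: "u * x \<in> ?K"
      if u: "u \<in> ideal_power ?U m" and bu: "\<And>j. b * (u * Poly_Mapping.lookup f j) \<in> ?K"
        and x: "x \<in> coeff_ideal (f * g')" for u x
    proof -
      have "u * Poly_Mapping.lookup (f * g') k \<in> ?K" for k
      proof (rule K_cancel)
        show "u * Poly_Mapping.lookup (Poly_Mapping.single t b * f) k + u * Poly_Mapping.lookup (f * g') k \<in> ?K"
          using ideal_multI[OF u lookup_in_coeff_ideal, of "f * g" k]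
          by (simp add: fg' lookup_add distrib_left)
        show "u * Poly_Mapping.lookup (Poly_Mapping.single t b * f) k \<in> ?K"
          using lookup_single_times_in_ideal[OF semiring_ideal_colon[OF K, of u], of b f t k] bu
          by (simp add: mult.left_commute)
      qed
      then show ?thesis using ideal_gen_colon[OF K _ x] by blast
    qed

    \<comment> \<open>An extra factor \<open>a\<close> pays that price: it joins \<open>b\<close> to
      form \<open>a * b\<close>, a coefficient of \<open>f * g\<close>, and the coefficient of
      \<open>f\<close> restores the exponent \<open>m\<close>.\<close>
    have aUV': "a * (u * v) \<in> ?K" if u: "u \<in> ideal_power ?U m" and v: "v \<in> ?V'" for u v
    proof (cases m)
      case 0
      show ?thesis using g'_zero[OF 0 v] semiring_ideal_zero[OF K] by simp
    next
      case (Suc l)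
      have "u * v \<in> ideal_mult (ideal_power ?U l) (coeff_ideal (f * g'))"
        using IH_g'[OF Suc] ideal_multI[OF u v] Suc by blast
      then show ?thesis
      proof (rule ideal_mult_colon[OF K, rotated])
        fix w x assume w: "w \<in> ideal_power ?U l" and x: "x \<in> coeff_ideal (f * g')"
        have "(a * w) * x \<in> ?K"
        proof (rule fg'_K[OF _ _ x])
          show "a * w \<in> ideal_power ?U m" unfolding Suc using a w by (simp add: ideal_multI)
          fix j
          have "Poly_Mapping.lookup f j * w \<in> ideal_power ?U m"
            unfolding Suc using w by (simp add: ideal_multI lookup_in_coeff_ideal)
          from K_ab[OF this] show "b * (a * w * Poly_Mapping.lookup f j) \<in> ?K"
            by (simp add: ac_simps)
        qed
        then show "a * (w * x) \<in> ?K" by (simp add: mult.assoc)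
      qed
    qed
    \<comment> \<open>This is what cancelling \<open>a X^s g\<close> from \<open>f * g\<close>
      requires in the next step.\<close>
    have aUg: "a * (u * Poly_Mapping.lookup g j) \<in> ?K" if u: "u \<in> ideal_power ?U m" for u j
      using lookup_g[of j]
    proof
      assume "Poly_Mapping.lookup g j = b"
      then show ?thesis using K_ab[OF u] by (simp add: ac_simps)
    next
      assume "Poly_Mapping.lookup g j \<in> range (Poly_Mapping.lookup g')"
      then show ?thesis using aUV'[OF u] ideal_gen_superset by blast
    qed

    have bU': "ideal_power ?U' (Suc m) \<subseteq> {u. b * u \<in> ?K}"
    proof
      fix u assume "u \<in> ideal_power ?U' (Suc m)"
      then have "u * b \<in> ideal_mult (ideal_power ?U' m) (coeff_ideal (f' * g))"
        using IH_f' ideal_multI lookup_in_coeff_ideal[of g t] unfolding b_def by blast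
      moreover have "ideal_mult (ideal_power ?U' m) (coeff_ideal (f' * g)) \<subseteq> ?K"
      proof (rule ideal_mult_least[OF K])
        fix w x assume "w \<in> ideal_power ?U' m" and x: "x \<in> coeff_ideal (f' * g)"
        then have w: "w \<in> ideal_power ?U m" using ideal_power_mono[OF f'_sub] by blast
        have "w * Poly_Mapping.lookup (f' * g) k \<in> ?K" for k
        proof (rule K_cancel)
          show "w * Poly_Mapping.lookup (Poly_Mapping.single s a * g) k + w * Poly_Mapping.lookup (f' * g) k \<in> ?K"
            using ideal_multI[OF w lookup_in_coeff_ideal, of "f * g" k]
            by (simp add: f'g lookup_add distrib_left)
          show "w * Poly_Mapping.lookup (Poly_Mapping.single s a * g) k \<in> ?K"
            using lookup_single_times_in_ideal[OF semiring_ideal_colon[OF K, of w], of a g s k] aUg[OF w]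
            by (simp add: mult.left_commute)
        qed
        then show "w * x \<in> ?K" using ideal_gen_colon[OF K _ x] by blast
      qed
      ultimately show "u \<in> {u. b * u \<in> ?K}" by (auto simp: mult.commute)
    qed
    have U_sub: "?U \<subseteq> ideal_gen (insert a ?U')" and U_sup: "ideal_gen (insert a ?U') \<subseteq> ?U"
      using lookup_f ideal_gen_superset[of "range (Poly_Mapping.lookup f')"]
        ideal_gen_superset[of "insert a ?U'"] a f'_sub
      by (intro ideal_gen_least[OF semiring_ideal_ideal_gen], blast)+
    \<comment> \<open>By \<open>ideal_power_insert_subset\<close>, it suffices to treat
      \<open>a c(f)^m\<close>, where \<open>a * b\<close> appears, and \<open>c(f')^(m+1)\<close>,
      which is \<open>bU'\<close>.\<close>
    have bU: "b * u \<in> ?K" if "u \<in> ideal_power ?U (Suc m)" for u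
    proof -
      have "ideal_power (ideal_gen (insert a ?U')) (Suc m) \<subseteq> {u. b * u \<in> ?K}"
      proof (rule ideal_power_insert_subset[OF semiring_ideal_colon[OF K] _ bU'])
        fix u assume "u \<in> ideal_power (ideal_gen (insert a ?U')) m"
        then have "u \<in> ideal_power ?U m" using ideal_power_mono[OF U_sup] by blast
        from K_ab[OF this] show "a * u \<in> {u. b * u \<in> ?K}" by (simp add: ac_simps)
      qed
      then show ?thesis using that ideal_power_mono[OF U_sub] by blast
    qed

    \<comment> \<open>The argument of \<open>aUV'\<close> is repeated with any \<open>x\<close> in
      \<open>c(f)\<close> in place of \<open>a\<close>; now \<open>bU\<close> supplies the condition
      of \<open>fg'_K\<close>.\<close>
    have UV': "u * v \<in> ?K" if u: "u \<in> ideal_power ?U (Suc m)" and v: "v \<in> ?V'" for u v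
    proof (cases m)
      case 0
      show ?thesis using g'_zero[OF 0 v] semiring_ideal_zero[OF K] by simp
    next
      case (Suc l)
      have "v * u \<in> ?K"
      proof (rule ideal_mult_colon[OF K _ u[unfolded ideal_power.simps]])
        fix x w assume x: "x \<in> ?U" and w: "w \<in> ideal_power ?U m"
        have "w * v \<in> ideal_mult (ideal_power ?U l) (coeff_ideal (f * g'))"
          using IH_g'[OF Suc] ideal_multI[OF w v] Suc by blast
        then have "x * (w * v) \<in> ?K"
        proof (rule ideal_mult_colon[OF K, rotated])
          fix w' y assume w': "w' \<in> ideal_power ?U l" and y: "y \<in> coeff_ideal (f * g')"
          have xw': "x * w' \<in> ideal_power ?U m" unfolding Suc using x w' by (simp add: ideal_multI)
          have "(x * w') * y \<in> ?K"
          proof (rule fg'_K[OF xw' _ y])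
            fix j
            have "Poly_Mapping.lookup f j * (x * w') \<in> ideal_power ?U (Suc m)"
              using xw' by (simp add: ideal_multI lookup_in_coeff_ideal)
            from bU[OF this] show "b * (x * w' * Poly_Mapping.lookup f j) \<in> ?K"
              by (simp add: mult.commute)
          qed
          then show "x * (w' * y) \<in> ?K" by (simp add: mult.assoc)
        qed
        then show "v * (x * w) \<in> ?K" by (simp add: ac_simps)
      qed
      then show ?thesis by (simp add: mult.commute)
    qed

    show ?thesis
    proof (rule ideal_mult_least[OF K])
      fix u v assume u: "u \<in> ideal_power ?U (Suc m)" and v: "v \<in> ?V"
      show "u * v \<in> ?K"
      proof (rule ideal_gen_colon[OF K _ v])
        fix y assume "y \<in> range (Poly_Mapping.lookup g)"
        then consider "y = b" | "y \<in> ?V'" using lookup_g ideal_gen_superset by blast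
        then show "u * y \<in> ?K"
          by cases (use bU[OF u] UV'[OF u] in \<open>simp_all add: mult.commute[of b]\<close>)
      qed
    qed
  qed
qed

section \<open>Subtractivity from the content formula\<close>

lemma subtractive_semiring_if_dedekind_mertens:
  assumes canc: "cancellative_monoid TYPE('g::comm_monoid_add)" and "\<exists>g::'g. g \<noteq> 0"
    and dm: "dedekind_mertens (monoid_semiring_embedding :: 's::comm_semiring_1 \<Rightarrow> ('g \<Rightarrow>\<^sub>0 's))"
  shows "subtractive_semiring TYPE('s)"
  unfolding subtractive_semiring_def subtractive_ideal_def
proof (intro allI impI conjI)
  fix I :: "'s set" and a b assume I: "semiring_ideal I" and abI: "a + b \<in> I" and aI: "a \<in> I"
  obtain g :: 'g where g: "g \<noteq> 0" using assms(2) by blast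
  \<comment> \<open>Since \<open>g\<close> differs from both 0 and \<open>g + g\<close>, the
    coefficient of \<open>h\<close> at \<open>g\<close> is exactly \<open>b\<close>.\<close>
  then have gg: "g \<noteq> g + g" using cancellative_monoid_cancel[OF canc, of g 0 g] by auto
  define X where "X = (Poly_Mapping.single g :: 's \<Rightarrow> _)"
  define f where "f = 1 + X 1"
  define h where "h = Poly_Mapping.single 0 a + X b + Poly_Mapping.single (g + g) a"
  have "Poly_Mapping.lookup f 0 = 1"
    using g by (simp add: f_def X_def lookup_add lookup_single lookup_one when_def)
  then have "1 \<in> coeff_ideal f" by (metis lookup_in_coeff_ideal)
  then have f: "coeff_ideal f = UNIV"
    using semiring_ideal_mult[OF semiring_ideal_ideal_gen, of 1] by (metis UNIV_eq_I mult_1_right)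
  have UNIV_mult: "ideal_mult UNIV J = J" if "semiring_ideal J" for J :: "'s set"
    using ideal_mult_least[OF that, of UNIV J] ideal_multI[of 1 UNIV _ J] semiring_ideal_mult[OF that]
    by fastforce
  have pow: "ideal_power UNIV n = (UNIV :: 's set)" for n
    by (induction n) (simp_all add: UNIV_mult semiring_ideal_UNIV)
  have fh: "f * h = Poly_Mapping.single 0 a + X (a + b)
      + Poly_Mapping.single (g + g) (a + b) + Poly_Mapping.single (g + g + g) a"
    by (simp add: f_def h_def X_def distrib_left distrib_right mult_single single_add ac_simps)
  \<comment> \<open>All powers of \<open>c(f) = S\<close> are \<open>S\<close>, so the unknown
    exponent disappears from the formula.\<close>
  have "coeff_ideal h = coeff_ideal (f * h)"
    using dm[unfolded dedekind_mertens_def content_monoid_semiring, rule_format, of f h]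
    unfolding f pow UNIV_mult[OF semiring_ideal_ideal_gen] by blast
  also have "\<dots> \<subseteq> I"
  proof (rule ideal_gen_least[OF I], safe)
    have "Poly_Mapping.lookup (Poly_Mapping.single l x) k \<in> I" if "x \<in> I" for l x and k :: 'g
      using that semiring_ideal_zero[OF I] by (simp add: lookup_single when_def)
    moreover have add: "x + y \<in> I" if "x \<in> I" "y \<in> I" for x y
      using I that unfolding semiring_ideal_def by blast
    ultimately show "Poly_Mapping.lookup (f * h) k \<in> I" for k
      unfolding fh X_def lookup_add using aI abI add by simp
  qed
  finally have "Poly_Mapping.lookup h g \<in> I" using lookup_in_coeff_ideal by (rule subsetD)
  moreover have "Poly_Mapping.lookup h g = b"
    using g gg[symmetric] by (simp add: h_def X_def lookup_add lookup_single when_def)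
  ultimately show "b \<in> I" by simp
qed

text \<open>For trivial \<open>G\<close>, \<open>S[G]\<close> is \<open>S\<close> with principal
  contents, and the formula holds even for the natural numbers, where the ideal generated by 2 and 3
  is not subtractive. Hence the assumption \<open>nontrivial\<close>.\<close>

theorem theorem3p13:
  assumes "cancellative_monoid TYPE('g::comm_monoid_add)"
    and "torsion_free_monoid TYPE('g)"
    and nontrivial: "\<exists>g::'g. g \<noteq> 0"
  shows "content_semialgebra
           (monoid_semiring_embedding :: 's::comm_semiring_1 \<Rightarrow> ('g \<Rightarrow>\<^sub>0 's))
         \<longleftrightarrow> subtractive_semiring TYPE('s)"
  unfolding content_semialgebra_monoid_semiring_iff
proof
  assume subtr: "subtractive_semiring TYPE('s)"
  show "dedekind_mertens (monoid_semiring_embedding :: 's \<Rightarrow> ('g \<Rightarrow>\<^sub>0 's))"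
    unfolding dedekind_mertens_def content_monoid_semiring
  proof (intro allI exI)
    fix f g :: "'g \<Rightarrow>\<^sub>0 's"
    let ?m = "card (Poly_Mapping.keys g)"
    show "ideal_mult (ideal_power (coeff_ideal f) (?m + 1)) (coeff_ideal g)
      = ideal_mult (ideal_power (coeff_ideal f) ?m) (coeff_ideal (f * g))"
      using dedekind_mertens_inclusion[OF assms(1,2) subtr, of g ?m f] coeff_ideal_times_subset[of f ?m g]
      by auto
  qed
qed (rule subtractive_semiring_if_dedekind_mertens[OF assms(1) nontrivial])

end
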